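(* For every integer $n\ge 3$, the set $\mathrm{GST}_n$ contains infinitely many points.
   Context: For $n\ge 2$ and $\mathbf p=(p_1,\dots,p_n)\in\mathbb R^n$ let $$\psi(\mathbf p)=\bigg(\frac{1}{2^{n-1}}\sum_{k=0}^{n-1}\binom{n-1}{k}p_{k+1}\bigg)^2-\frac{1}{2^{n-1}}\sum_{k=0}^{n-2}\binom{n-2}{k}\big(p_{k+2}^2+p_{k+1}p_{n-(k+1)}\big).$$ Put $\mathrm{Ind}_n=\{\mathbf p\in[0,1]^n:\psi(\mathbf p)=0\}$. For $x\in\{0,1\}^n$ and $1\le i\le n$ put $\pi_i(x)=p_k$ with $k=\#\{j: x_j=x_i\}$. $\mathrm{Inf}_n$ is the set of $\mathbf p\in[0,1]^n$ such that for all $1\le i,j\le n$ there is $x\in\{0,1\}^n$ with $\pi_i(x)\neq\pi_i(x')$, where $x'$ is $x$ with its $j$-th coordinate flipped. $\mathrm{GST}_n=\mathrm{Ind}_n\cap\mathrm{Inf}_n$. *)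

theory Defs
  imports Complex_Main "HOL-Library.FuncSet"
begin

text \<open>
  A point of \<open>[0,1]^n\<close> is an extensional function on the index set \<open>{1..n}\<close>, i.e. an element
  of \<open>{1..n} \<rightarrow>\<^sub>E {0..1}\<close>.  Extensionality makes the representation unique, so that the
  cardinality of a set of such functions is that of the set of points they represent.
  Likewise \<open>{0,1}^n\<close> is \<open>{1..n} \<rightarrow>\<^sub>E {0,1}\<close>.  The definitions are meant for \<open>n \<ge> 2\<close>; then no
  subtraction of natural numbers below is truncated and every index lies in \<open>{1..n}\<close>.
\<close>

definition psi :: "nat \<Rightarrow> (nat \<Rightarrow> real) \<Rightarrow> real" where
  "psi n p =
     (1 / 2 ^ (n - 1) * (\<Sum>k = 0..n - 1. real ((n - 1) choose k) * p (k + 1)))\<^sup>2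
     - 1 / 2 ^ (n - 1) *
       (\<Sum>k = 0..n - 2. real ((n - 2) choose k) *
          ((p (k + 2))\<^sup>2 + p (k + 1) * p (n - (k + 1))))"

definition Ind :: "nat \<Rightarrow> (nat \<Rightarrow> real) set" where
  "Ind n = {p \<in> {1..n} \<rightarrow>\<^sub>E {0..1}. psi n p = 0}"

definition cube_pi :: "nat \<Rightarrow> (nat \<Rightarrow> real) \<Rightarrow> nat \<Rightarrow> (nat \<Rightarrow> nat) \<Rightarrow> real" where
  "cube_pi n p i x = p (card {j \<in> {1..n}. x j = x i})"

definition flip :: "nat \<Rightarrow> (nat \<Rightarrow> nat) \<Rightarrow> (nat \<Rightarrow> nat)" where
  "flip j x = x(j := 1 - x j)"

definition Infl :: "nat \<Rightarrow> (nat \<Rightarrow> real) set" where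
  "Infl n = {p \<in> {1..n} \<rightarrow>\<^sub>E {0..1}.
     \<forall>i \<in> {1..n}. \<forall>j \<in> {1..n}. \<exists>x \<in> {1..n} \<rightarrow>\<^sub>E {0, 1}.
       cube_pi n p i x \<noteq> cube_pi n p i (flip j x)}"

definition GST :: "nat \<Rightarrow> (nat \<Rightarrow> real) set" where
  "GST n = Ind n \<inter> Infl n"

end

theory Submission
  imports Defs
begin

text \<open>
  Scaling preserves the zeros of the quadratic form \<open>psi n\<close>, so one suitable zero gives a ray of
  them.  On the points \<open>(1, t, \<dots>, t, 0)\<close>, with \<open>N = 2 ^ (n - 1)\<close>, one finds
  \<open>N\<^sup>2 psi = (1 - 2 t)\<^sup>2 - N t\<^sup>2\<close>, which vanishes at \<open>t = 1 / (2 + sqrt N)\<close>.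
  The constant configuration \<open>x = 0\<close> witnesses every influence: flipping coordinate \<open>j\<close> changes
  the value for \<open>i\<close> from \<open>p\<^sub>n = 0\<close> to \<open>p\<^sub>1\<close> or \<open>p\<^sub>n\<^sub>-\<^sub>1\<close>.
\<close>

definition plateau :: "nat \<Rightarrow> real \<Rightarrow> real \<Rightarrow> nat \<Rightarrow> real" where
  "plateau n a b = (\<lambda>k\<in>{1..n}. if k = 1 then a else if k = n then 0 else b)"

lemma sum_binomial_real: "(\<Sum>k = 0..m. real (m choose k)) = 2 ^ m"
  using choose_row_sum[of m] by (simp add: atLeast0AtMost flip: of_nat_sum)

text \<open>The point differs from the constant \<open>b\<close> only at the indices 1 and
  \<open>n\<close>, so each sum is a full binomial row plus corrections at its two end
  terms.\<close>

lemma psi_plateau: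
  assumes "n \<ge> 3"
  shows "(2 ^ (n - 1))\<^sup>2 * psi n (plateau n a b) = (a - 2 * b)\<^sup>2 - 2 ^ (n - 1) * b\<^sup>2"
proof -
  obtain m where n: "n = m + 3"
    using assms by (metis add.commute le_Suc_ex)
  define M :: real where "M = 2 ^ (m + 1)"
  have mean: "(\<Sum>k = 0..m + 2. real ((m + 2) choose k) * plateau n a b (k + 1)) = a - 2 * b + 2 * M * b"
  proof -
    have "(\<Sum>k = 0..m + 2. real ((m + 2) choose k) * plateau n a b (k + 1))
        = (\<Sum>k = 0..m + 2. b * real ((m + 2) choose k) + (if k = 0 then a - b else 0)
            + (if k = m + 2 then - b else 0))"
      by (rule sum.cong) (auto simp: plateau_def n algebra_simps)
    also have "\<dots> = b * 2 ^ (m + 2) + (a - b) - b"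
      by (simp only: sum.distrib sum_distrib_left[symmetric] sum_binomial_real) simp
    finally show ?thesis
      by (simp add: M_def algebra_simps)
  qed
  \<comment> \<open>As \<open>n \<ge> 3\<close>, the index \<open>n - 1\<close> is neither 1 nor
    \<open>n\<close>, so the product in both end terms is \<open>a * b\<close>; the square vanishes
    in the last one only.\<close>
  have "(\<Sum>k = 0..m + 1. real ((m + 1) choose k) *
          ((plateau n a b (k + 2))\<^sup>2 + plateau n a b (k + 1) * plateau n a b (n - (k + 1))))
      = (\<Sum>k = 0..m + 1. 2 * b\<^sup>2 * real ((m + 1) choose k) + (if k = 0 then a * b - b\<^sup>2 else 0)
            + (if k = m + 1 then a * b - 2 * b\<^sup>2 else 0))"
    by (rule sum.cong) (auto simp: plateau_def n power2_eq_square algebra_simps)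
  also have "\<dots> = 2 * b\<^sup>2 * 2 ^ (m + 1) + (a * b - b\<^sup>2) + (a * b - 2 * b\<^sup>2)"
    by (simp only: sum.distrib sum_distrib_left[symmetric] sum_binomial_real) simp
  finally have corr: "(\<Sum>k = 0..m + 1. real ((m + 1) choose k) *
          ((plateau n a b (k + 2))\<^sup>2 + plateau n a b (k + 1) * plateau n a b (n - (k + 1))))
      = 2 * M * b\<^sup>2 + 2 * a * b - 3 * b\<^sup>2"
    by (simp add: M_def algebra_simps)
  have idx: "n - 1 = m + 2" "n - 2 = m + 1" and pow: "(2::real) ^ (m + 2) = 2 * M" and "M > 0"
    by (simp_all add: n M_def)
  have psi: "psi n (plateau n a b)
      = (1 / (2 * M) * (a - 2 * b + 2 * M * b))\<^sup>2
        - 1 / (2 * M) * (2 * M * b\<^sup>2 + 2 * a * b - 3 * b\<^sup>2)"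
    unfolding psi_def idx mean corr pow ..
  \<comment> \<open>After multiplication by \<open>(2 * M)\<^sup>2\<close> the terms in
    \<open>M\<^sup>2 * b\<^sup>2\<close> and \<open>M * a * b\<close> cancel, and -8 + 6 leaves
    \<open>- 2 * M * b\<^sup>2\<close>.\<close>
  then show ?thesis
    unfolding psi idx pow using \<open>M > 0\<close> by (simp add: field_simps power2_eq_square)
qed

lemma plateau_in_Infl:
  assumes "n \<ge> 3" "0 < a" "a \<le> 1" "0 < b" "b \<le> 1"
  shows "plateau n a b \<in> Infl n"
proof -
  let ?p = "plateau n a b" and ?x = "\<lambda>k\<in>{1..n}. 0 :: nat"
  have "cube_pi n ?p i ?x \<noteq> cube_pi n ?p i (flip j ?x)" if "i \<in> {1..n}" "j \<in> {1..n}" for i j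
  proof -
    have "{k \<in> {1..n}. ?x k = ?x i} = {1..n}"
      using that by auto
    then have "cube_pi n ?p i ?x = 0"
      using assms by (simp add: cube_pi_def plateau_def)
    \<comment> \<open>The flipped coordinate stands alone against the other \<open>n - 1\<close>,
      and \<open>n - 1\<close> is an interior index of the plateau.\<close>
    moreover have "{k \<in> {1..n}. flip j ?x k = flip j ?x i} = (if i = j then {j} else {1..n} - {j})"
      using that by (auto simp: flip_def)
    then have "cube_pi n ?p i (flip j ?x) = (if i = j then a else b)"
      using that assms by (cases "i = j") (simp_all add: cube_pi_def plateau_def, linarith)
    ultimately show ?thesis
      using assms by simp
  qed
  moreover have "?x \<in> {1..n} \<rightarrow>\<^sub>E {0, 1}" "?p \<in> {1..n} \<rightarrow>\<^sub>E {0..1}"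
    using assms by (auto simp: plateau_def)
  ultimately show ?thesis
    unfolding Infl_def by blast
qed

theorem mainTheorem4:
  fixes n :: nat
  assumes "n \<ge> 3"
  shows "infinite (GST n)"
proof -
  define s :: real where "s = sqrt (2 ^ (n - 1))"
  have "s > 0" and s2: "s\<^sup>2 = 2 ^ (n - 1)"
    by (simp_all add: s_def)
  define f where "f c = plateau n c (c / (2 + s))" for c
  \<comment> \<open>The bound \<open>c \<le> 1\<close> keeps the ray inside the cube;
    \<open>c = 0\<close> would give the zero point, which has no influence.\<close>
  have "f c \<in> GST n" if "c \<in> {0<..1}" for c
  proof -
    have "c / (2 + s) \<le> 1" "0 < c / (2 + s)"
      using that \<open>s > 0\<close> by (simp_all add: field_simps)
    then have "f c \<in> Infl n"
      using plateau_in_Infl[OF assms] that by (simp add: f_def)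
    \<comment> \<open>With \<open>s\<^sup>2 = 2 ^ (n - 1)\<close> the form is a difference of
      squares, and this is the vanishing of one linear factor.\<close>
    have "c - 2 * (c / (2 + s)) = s * (c / (2 + s))"
      using \<open>s > 0\<close> by (simp add: field_simps)
    then have "(2 ^ (n - 1))\<^sup>2 * psi n (f c) = 0"
      unfolding f_def psi_plateau[OF assms] by (simp add: power_mult_distrib s2 del: times_divide_eq_right)
    with \<open>f c \<in> Infl n\<close> show ?thesis
      by (simp add: GST_def Ind_def Infl_def)
  qed
  moreover have "inj f"
  proof (rule injI)
    fix c d assume "f c = f d"
    then have "f c 1 = f d 1" by simp
    then show "c = d" using assms by (simp add: f_def plateau_def)
  qed
  then have "infinite (f ` {0<..1})"
    using finite_imageD[OF _ inj_on_subset[OF _ subset_UNIV]] infinite_Ioc[OF zero_less_one] by blast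
  ultimately show ?thesis
    using infinite_super[OF image_subsetI] by blast
qed

end
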